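(* In the graceful game, Bob has a winning strategy on every prism $P_{r,2}=C_r\,\square\,P_2$, $r\geq 3$ (no matter who starts).
   Context: $C_r$ is the cycle on $r$ vertices, $P_2$ the path on $2$ vertices, and $\square$ the Cartesian product of graphs. A graceful labeling of a graph $G$ with $m$ edges is an injective map $f\colon V(G)\to\{0,1,\dots,m\}$ such that the induced edge labels $|f(u)-f(v)|$, $uv\in E(G)$, are pairwise distinct. The graceful game on a simple graph $G$ with $m$ edges: two players, Alice and Bob, alternately choose a free (not yet labeled) vertex and assign to it a label from $\{0,1,\dots,m\}$ not yet used. An edge both of whose endpoints are labeled gets label $|f(u)-f(v)|$; a move is legal only if after it all edge labels are pairwise distinct. Alice wins if the whole graph ends up gracefully labeled; Bob wins if he can prevent this. Either player may be the first to move. *)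

theory Defs
  imports Main
begin

record 'a graph =
  verts :: "'a set"
  edges :: "'a set set"

definition cycle_graph :: "nat \<Rightarrow> nat graph" where
  "cycle_graph r =
     \<lparr> verts = {..<r}, edges = {{i, (i + 1) mod r} | i. i < r} \<rparr>"

definition path_graph :: "nat \<Rightarrow> nat graph" where
  "path_graph n =
     \<lparr> verts = {..<n}, edges = {{i, i + 1} | i. i + 1 < n} \<rparr>"

definition cartesian_product :: "'a graph \<Rightarrow> 'b graph \<Rightarrow> ('a \<times> 'b) graph" where
  "cartesian_product G H =
     \<lparr> verts = verts G \<times> verts H,
       edges = {{(u, x), (v, x)} | u v x. {u, v} \<in> edges G \<and> x \<in> verts H}
             \<union> {{(u, x), (u, y)} | u x y. u \<in> verts G \<and> {x, y} \<in> edges H} \<rparr>"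

definition prism :: "nat \<Rightarrow> (nat \<times> nat) graph" where
  "prism r = cartesian_product (cycle_graph r) (path_graph 2)"

definition edge_label :: "('a \<Rightarrow> nat) \<Rightarrow> 'a set \<Rightarrow> nat" where
  "edge_label f e =
     (THE d. \<exists>u v. e = {u, v} \<and> d = nat \<bar>int (f u) - int (f v)\<bar>)"

lemma edge_label_doubleton:
  "edge_label f {u, v} = nat \<bar>int (f u) - int (f v)\<bar>"
  unfolding edge_label_def
  by (rule the_equality) (auto simp: doubleton_eq_iff)

definition graceful_labeling :: "'a graph \<Rightarrow> ('a \<Rightarrow> nat) \<Rightarrow> bool" where
  "graceful_labeling G f \<longleftrightarrow>
     inj_on f (verts G) \<and> f ` verts G \<subseteq> {0..card (edges G)} \<and>
     inj_on (edge_label f) (edges G)"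

datatype player = Alice | Bob

fun opponent :: "player \<Rightarrow> player" where
  "opponent Alice = Bob"
| "opponent Bob = Alice"

type_synonym 'a move = "'a \<times> nat"

text \<open>
  A play is the chronological list of moves made so far. No vertex occurs twice in a
  legal play \<open>h\<close>, so \<open>map_of h\<close> is the partial labeling reached by \<open>h\<close>.
\<close>

definition legal_move :: "'a graph \<Rightarrow> 'a move list \<Rightarrow> 'a move \<Rightarrow> bool" where
  "legal_move G h mv \<longleftrightarrow>
     (let p = map_of h; (v, l) = mv; q = p(v \<mapsto> l) in
        v \<in> verts G \<and> v \<notin> dom p \<and>
        l \<in> {0..card (edges G)} \<and> l \<notin> ran p \<and>
        inj_on (edge_label (the \<circ> q)) {e \<in> edges G. e \<subseteq> dom q})"

definition finished :: "'a graph \<Rightarrow> 'a move list \<Rightarrow> bool" where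
  "finished G h \<longleftrightarrow> (\<nexists>mv. legal_move G h mv)"

definition winner :: "'a graph \<Rightarrow> 'a move list \<Rightarrow> player" where
  "winner G h =
     (if dom (map_of h) = verts G \<and> graceful_labeling G (the \<circ> map_of h)
      then Alice else Bob)"

definition to_move :: "player \<Rightarrow> 'a move list \<Rightarrow> player" where
  "to_move first h = (if even (length h) then first else opponent first)"

type_synonym 'a strategy = "'a move list \<Rightarrow> 'a move"

inductive play_with :: "'a graph \<Rightarrow> player \<Rightarrow> player \<Rightarrow> 'a strategy \<Rightarrow> 'a move list \<Rightarrow> bool"
  for G first P \<sigma> where
  start: "play_with G first P \<sigma> []"
| own_move: "play_with G first P \<sigma> h \<Longrightarrow> to_move first h = P \<Longrightarrow> legal_move G h (\<sigma> h)
    \<Longrightarrow> play_with G first P \<sigma> (h @ [\<sigma> h])"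
| opponent_move: "play_with G first P \<sigma> h \<Longrightarrow> to_move first h \<noteq> P \<Longrightarrow> legal_move G h mv
    \<Longrightarrow> play_with G first P \<sigma> (h @ [mv])"

text \<open>
  The first conjunct forces a strategy to move whenever a legal move exists: a player
  may not stall.
\<close>

definition winning_strategy :: "'a graph \<Rightarrow> player \<Rightarrow> player \<Rightarrow> 'a strategy \<Rightarrow> bool" where
  "winning_strategy G first P \<sigma> \<longleftrightarrow>
     (\<forall>h. play_with G first P \<sigma> h \<and> to_move first h = P \<and> \<not> finished G h
        \<longrightarrow> legal_move G h (\<sigma> h)) \<and>
     (\<forall>h. play_with G first P \<sigma> h \<and> finished G h \<longrightarrow> winner G h = P)"

definition has_winning_strategy :: "'a graph \<Rightarrow> player \<Rightarrow> player \<Rightarrow> bool" where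
  "has_winning_strategy G first P \<longleftrightarrow> (\<exists>\<sigma>. winning_strategy G first P \<sigma>)"

end

theory Submission
  imports Defs
begin

text \<open>
  Write m = 3 r for the number of edges. In a graceful labeling every edge label from 1 to m occurs,
  so 0 and m must be adjacent, and the edge labels m - 1 and m - 2 also leave few possibilities.
  Bob plays until no graceful completion exists; from then on any legal moves will do.

  For r > 3 the neighbours of a vertex are pairwise non-adjacent. If Alice opens with a label l at
  a, complementing all labels we may assume l \<le> m / 2. If l = 0, Bob puts m on a non-neighbour.
  Otherwise Bob puts 0 on the partner v of a. He next completes a pair of labels around v consisting
  of 1 and a label below m - 1, which kills the edge label m - 1, or puts m on a non-neighbour of v,
  which kills the edge label m. If Bob opens, he puts 0 on v; Alice has to answer with m next to v,
  Bob puts 1 next to v, Alice has to put m - 1 on the last neighbour of v, and 2 on a vertex at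
  distance at least 3 from v kills the edge label m - 2.

  For r = 3 an exhaustive search shows that a vertex labelled 3 has a partner labelled 9, and that
  3 and 6 never occur together.
\<close>

section \<open>Positions without graceful completion\<close>

definition adj :: "'a graph \<Rightarrow> 'a \<Rightarrow> 'a \<Rightarrow> bool" where
  "adj G u v \<longleftrightarrow> {u, v} \<in> edges G"

lemma adj_commute: "adj G u v \<longleftrightarrow> adj G v u"
  by (simp add: adj_def insert_commute)

lemma not_adj_sym: "\<not> adj G u v \<Longrightarrow> \<not> adj G v u"
  by (simp add: adj_commute)

abbreviation gap :: "nat \<Rightarrow> nat \<Rightarrow> nat" where
  "gap k l \<equiv> nat \<bar>int k - int l\<bar>"

section \<open>Positions as partial labelings, and those won by Bob\<close>

definition consistent :: "'a graph \<Rightarrow> ('a \<rightharpoonup> nat) \<Rightarrow> bool" where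
  "consistent G p \<longleftrightarrow> inj_on (edge_label (the \<circ> p)) {e \<in> edges G. e \<subseteq> dom p}"

definition legal :: "'a graph \<Rightarrow> ('a \<rightharpoonup> nat) \<Rightarrow> 'a \<Rightarrow> nat \<Rightarrow> bool" where
  "legal G p v l \<longleftrightarrow> v \<in> verts G \<and> v \<notin> dom p \<and> l \<le> card (edges G) \<and> l \<notin> ran p \<and>
     consistent G (p(v \<mapsto> l))"

lemma legal_move_iff: "legal_move G h (v, l) \<longleftrightarrow> legal G (map_of h) v l"
  by (simp add: legal_move_def legal_def consistent_def Let_def)

definition dead :: "'a graph \<Rightarrow> ('a \<rightharpoonup> nat) \<Rightarrow> bool" where
  "dead G p \<longleftrightarrow> (\<nexists>f. graceful_labeling G f \<and> (\<forall>v l. p v = Some l \<longrightarrow> f v = l))"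

lemma dead_update: "dead G p \<Longrightarrow> v \<notin> dom p \<Longrightarrow> dead G (p(v \<mapsto> l))"
  unfolding dead_def by (metis domI fun_upd_other)

text \<open>A position is a partial labeling with the player to move, since the order of the earlier
  moves does not affect legality. In \<open>alice\<close> the premise on \<open>dom p\<close>
  settles the case where Alice has no legal move: the play then ends with an unlabeled vertex, and
  Bob wins.\<close>

inductive bob_wins :: "'a graph \<Rightarrow> player \<Rightarrow> ('a \<rightharpoonup> nat) \<Rightarrow> bool" for G where
  dead: "dead G p \<Longrightarrow> bob_wins G P p"
| bob: "legal G p v l \<Longrightarrow> bob_wins G Alice (p(v \<mapsto> l)) \<Longrightarrow> bob_wins G Bob p"
| alice: "dom p \<noteq> verts G \<Longrightarrow> (\<And>v l. legal G p v l \<Longrightarrow> bob_wins G Bob (p(v \<mapsto> l)))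
    \<Longrightarrow> bob_wins G Alice p"

lemma to_move_snoc: "to_move first (h @ [mv]) = opponent (to_move first h)"
  by (cases first) (auto simp: to_move_def)

lemma map_of_snoc: "v \<notin> dom (map_of h) \<Longrightarrow> map_of (h @ [(v, l)]) = (map_of h)(v \<mapsto> l)"
  by (rule ext) (auto simp: map_add_def dom_def split: option.splits)

text \<open>The strategy picks any legal move to a position again won by Bob, so being won is an
  invariant of the plays that follow it. At the end of a play each rule makes Bob the winner: a dead
  position is not gracefully labeled, \<open>bob\<close> offers a legal move, and under
  \<open>alice\<close> a vertex is unlabeled.\<close>

lemma bob_wins_imp_winning_strategy:
  assumes "bob_wins G first Map.empty"
  shows "has_winning_strategy G first Bob"
proof -
  define W where "W h \<longleftrightarrow> bob_wins G (to_move first h) (map_of h)" for h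
  define \<sigma> where "\<sigma> h = (SOME mv. legal_move G h mv \<and> W (h @ [mv]))" for h
  \<comment> \<open>\<open>L\<close> is needed for dead positions, which by themselves promise no
    legal move; if there is one, any will do.\<close>
  have good: "legal_move G h (\<sigma> h) \<and> W (h @ [\<sigma> h])"
    if W: "W h" and B: "to_move first h = Bob" and L: "legal_move G h mv" for h mv
  proof -
    have "\<exists>mv. legal_move G h mv \<and> W (h @ [mv])"
      using W[unfolded W_def B]
    proof cases
      case dead
      obtain v l where mv: "mv = (v, l)" by (cases mv)
      then have nv: "v \<notin> dom (map_of h)" using L by (simp add: legal_move_iff legal_def)
      have "dead G (map_of (h @ [mv]))"
        unfolding mv map_of_snoc[OF nv] by (rule dead_update[OF dead(1) nv])
      then have "W (h @ [mv])" unfolding W_def by (rule bob_wins.dead)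
      then show ?thesis using L by blast
    next
      case (bob v l)
      have nv: "v \<notin> dom (map_of h)" using bob by (simp add: legal_def)
      have "W (h @ [(v, l)])" unfolding W_def using bob B
        by (simp only: map_of_snoc[OF nv] to_move_snoc opponent.simps)
      moreover have "legal_move G h (v, l)" using bob by (simp add: legal_move_iff)
      ultimately show ?thesis by blast
    qed
    then show ?thesis unfolding \<sigma>_def by (rule someI_ex)
  qed
  have inv: "W h" if "play_with G first Bob \<sigma> h" for h
    using that
  proof induction
    case start
    then show ?case using assms by (simp add: W_def to_move_def)
  next
    case (own_move h)
    then show ?case using good by blast
  next
    case (opponent_move h mv)
    obtain v l where mv: "mv = (v, l)" by (cases mv)
    have A: "to_move first h = Alice" using opponent_move by (cases "to_move first h") auto
    have L: "legal G (map_of h) v l" using opponent_move mv by (simp add: legal_move_iff)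
    then have v: "v \<notin> dom (map_of h)" by (simp add: legal_def)
    have "bob_wins G Bob ((map_of h)(v \<mapsto> l))"
      using opponent_move.IH[unfolded W_def A]
    proof cases
      case dead
      show ?thesis by (rule bob_wins.dead[OF dead_update[OF dead(1) v]])
    next
      case alice
      show ?thesis by (rule alice(2)[OF L])
    qed
    then show ?case unfolding W_def mv
      by (simp only: map_of_snoc[OF v] to_move_snoc A opponent.simps)
  qed
  have "winning_strategy G first Bob \<sigma>"
    unfolding winning_strategy_def
  proof (intro conjI allI impI; elim conjE)
    fix h assume "play_with G first Bob \<sigma> h" "to_move first h = Bob" "\<not> finished G h"
    then show "legal_move G h (\<sigma> h)" using good inv unfolding finished_def by blast
  next
    fix h assume h: "play_with G first Bob \<sigma> h" and fin: "finished G h"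
    have nd: "winner G h = Bob" if "dead G (map_of h)"
      using that unfolding dead_def winner_def by auto
    show "winner G h = Bob"
      using inv[OF h] unfolding W_def
    proof cases
      case dead
      then show ?thesis by (rule nd)
    next
      case (bob v l)
      then have "legal_move G h (v, l)" by (simp add: legal_move_iff)
      then show ?thesis using fin by (simp add: finished_def)
    next
      case alice
      then show ?thesis by (simp add: winner_def)
    qed
  qed
  then show ?thesis unfolding has_winning_strategy_def by blast
qed

locale simple_graph =
  fixes G :: "'a graph" and m :: nat
  defines "m \<equiv> card (edges G)"
  assumes finite_edges: "finite (edges G)"
    and edge_cases: "e \<in> edges G \<Longrightarrow> \<exists>u v. e = {u, v} \<and> u \<noteq> v \<and> u \<in> verts G \<and> v \<in> verts G"
begin

lemma adj_irrefl: "\<not> adj G u u"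
  using edge_cases[of "{u, u}"] by (auto simp: adj_def doubleton_eq_iff)

lemma adj_verts: "adj G u v \<Longrightarrow> u \<in> verts G \<and> v \<in> verts G"
  using edge_cases[of "{u, v}"] by (auto simp: adj_def doubleton_eq_iff)

text \<open>The m edges have m distinct labels, none of them 0 because vertex labels are distinct,
  so each of 1, ..., m occurs. The edge is oriented with its larger label at
  \<open>u\<close>.\<close>

lemma graceful_label_attained:
  assumes f: "graceful_labeling G f" and d: "1 \<le> d" "d \<le> m"
  shows "\<exists>u v. adj G u v \<and> f u = f v + d"
proof -
  have inj: "inj_on f (verts G)" and le: "\<And>v. v \<in> verts G \<Longrightarrow> f v \<le> m"
    and inje: "inj_on (edge_label f) (edges G)"
    using f unfolding graceful_labeling_def m_def by auto
  have sub: "edge_label f ` edges G \<subseteq> {1..m}"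
  proof
    fix x assume "x \<in> edge_label f ` edges G"
    then obtain e where e: "e \<in> edges G" "x = edge_label f e" by blast
    then obtain u v where uv: "e = {u, v}" "u \<noteq> v" "u \<in> verts G" "v \<in> verts G"
      using edge_cases by blast
    then have "f u \<noteq> f v" using inj by (auto simp: inj_on_def)
    moreover have "f u \<le> m" "f v \<le> m" using uv le by auto
    ultimately show "x \<in> {1..m}" using e uv by (auto simp: edge_label_doubleton)
  qed
  have "card (edge_label f ` edges G) = m" using inje by (simp add: card_image m_def)
  then have "edge_label f ` edges G = {1..m}"
    using sub by (intro card_subset_eq) auto
  then obtain e where e: "e \<in> edges G" "d = edge_label f e" using d by force
  then obtain u v where uv: "e = {u, v}" using edge_cases by blast
  then have "gap (f u) (f v) = d" "adj G u v" using e by (auto simp: edge_label_doubleton adj_def)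
  then have "f u = f v + d \<and> adj G u v \<or> f v = f u + d \<and> adj G v u"
    by (auto simp: adj_commute)
  then show ?thesis by blast
qed

lemma graceful_le: "graceful_labeling G f \<Longrightarrow> v \<in> verts G \<Longrightarrow> f v \<le> m"
  unfolding graceful_labeling_def m_def by auto

lemma graceful_inj:
  "graceful_labeling G f \<Longrightarrow> u \<in> verts G \<Longrightarrow> v \<in> verts G \<Longrightarrow> f u = f v \<longleftrightarrow> u = v"
  unfolding graceful_labeling_def inj_on_def by auto

text \<open>Only the edges from \<open>u\<close> to labeled neighbours are new. Their labels are
  compared with the old ones in \<open>old\<close> and with each other in \<open>new\<close>. By
  symmetry of adjacency \<open>k1 \<le> k2\<close> may be assumed, so that an old label is a plain
  subtraction.\<close>

lemma legalI:
  assumes u: "u \<in> verts G" "p u = None" "y \<le> m" "y \<notin> ran p" and c: "consistent G p"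
    and old: "\<And>w k w1 k1 w2 k2. \<lbrakk>adj G u w; p w = Some k; adj G w1 w2; p w1 = Some k1;
      p w2 = Some k2; k1 \<le> k2\<rbrakk> \<Longrightarrow> gap y k \<noteq> k2 - k1"
    and new: "\<And>w k w' k'. \<lbrakk>adj G u w; p w = Some k; adj G u w'; p w' = Some k'; w \<noteq> w'\<rbrakk>
      \<Longrightarrow> gap y k \<noteq> gap y k'"
  shows "legal G p u y"
proof -
  let ?q = "p(u \<mapsto> y)"
  have old': "gap y k \<noteq> gap k1 k2"
    if "adj G u w" "p w = Some k" "adj G w1 w2" "p w1 = Some k1" "p w2 = Some k2" for w k w1 k1 w2 k2
  proof (cases "k1 \<le> k2")
    case True
    then show ?thesis using old[OF that] by linarith
  next
    case False
    have "adj G w2 w1" using that adj_commute by metis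
    then show ?thesis using old[OF that(1,2) _ that(5,4)] False by linarith
  qed
  have rep: "(\<exists>w k. e = {u, w} \<and> w \<noteq> u \<and> adj G u w \<and> p w = Some k \<and> edge_label (the \<circ> ?q) e = gap y k) \<or>
       (\<exists>w1 k1 w2 k2. e = {w1, w2} \<and> w1 \<noteq> u \<and> w2 \<noteq> u \<and> adj G w1 w2 \<and> p w1 = Some k1 \<and> p w2 = Some k2
          \<and> edge_label (the \<circ> ?q) e = gap k1 k2 \<and> edge_label (the \<circ> p) e = gap k1 k2)"
    if e: "e \<in> edges G" "e \<subseteq> dom ?q" for e
  proof -
    obtain x z where xz: "e = {x, z}" "x \<noteq> z" using edge_cases e by blast
    then have a: "adj G x z" using e by (simp add: adj_def)
    consider "x = u" | "z = u" | "x \<noteq> u" "z \<noteq> u" by blast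
    then show ?thesis
    proof cases
      case 1
      then obtain k where "p z = Some k" using e xz by auto
      then show ?thesis using 1 xz a
        by (intro disjI1 exI[of _ z] exI[of _ k]) (simp add: edge_label_doubleton)
    next
      case 2
      then obtain k where k: "p x = Some k" using e xz by auto
      have e': "e = {u, x}" "adj G u x" using 2 xz a adj_commute by (metis insert_commute)+
      then show ?thesis using 2 xz k
        by (intro disjI1 exI[of _ x] exI[of _ k]) (simp add: edge_label_doubleton)
    next
      case 3
      then obtain k k' where "p x = Some k" "p z = Some k'" using e xz by auto
      then show ?thesis using 3 xz a
        by (intro disjI2 exI[of _ x] exI[of _ k] exI[of _ z] exI[of _ k'])
          (simp add: edge_label_doubleton)
    qed
  qed
  have "consistent G ?q"
    unfolding consistent_def
  proof (rule inj_onI; elim CollectE conjE)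
    fix e e' assume e: "e \<in> edges G" "e \<subseteq> dom ?q" and e': "e' \<in> edges G" "e' \<subseteq> dom ?q"
      and eq: "edge_label (the \<circ> ?q) e = edge_label (the \<circ> ?q) e'"
    have old_eq: "e = e'" if "e \<subseteq> dom p" "e' \<subseteq> dom p" "edge_label (the \<circ> p) e = edge_label (the \<circ> p) e'"
      using c that e e' unfolding consistent_def inj_on_def by blast
    from rep[OF e] show "e = e'"
    proof (elim disjE exE conjE)
      fix w k
      assume 1: "e = {u, w}" "adj G u w" "p w = Some k" "edge_label (the \<circ> ?q) e = gap y k"
      from rep[OF e'] show ?thesis
      proof (elim disjE exE conjE)
        fix w' k'
        assume "e' = {u, w'}" "adj G u w'" "p w' = Some k'" "edge_label (the \<circ> ?q) e' = gap y k'"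
        then show ?thesis using new[of w k w' k'] eq 1 by (cases "w = w'") auto
      next
        fix w1 k1 w2 k2
        assume "adj G w1 w2" "p w1 = Some k1" "p w2 = Some k2" "edge_label (the \<circ> ?q) e' = gap k1 k2"
        then show ?thesis using old'[of w k w1 w2 k1 k2] eq 1 by metis
      qed
    next
      fix w1 k1 w2 k2
      assume 1: "e = {w1, w2}" "adj G w1 w2" "p w1 = Some k1" "p w2 = Some k2"
        "edge_label (the \<circ> ?q) e = gap k1 k2" "edge_label (the \<circ> p) e = gap k1 k2"
      from rep[OF e'] show ?thesis
      proof (elim disjE exE conjE)
        fix w k
        assume "adj G u w" "p w = Some k" "edge_label (the \<circ> ?q) e' = gap y k"
        then show ?thesis using old'[of w k w1 w2 k1 k2] eq 1 by metis
      next
        fix w1' k1' w2' k2'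
        assume "e' = {w1', w2'}" "p w1' = Some k1'" "p w2' = Some k2'"
          "edge_label (the \<circ> ?q) e' = gap k1' k2'" "edge_label (the \<circ> p) e' = gap k1' k2'"
        then show ?thesis using eq 1 by (intro old_eq) auto
      qed
    qed
  qed
  then show ?thesis using u unfolding legal_def m_def by blast
qed

section \<open>Complementation of labels\<close>

lemma gap_complement: "k \<le> n \<Longrightarrow> l \<le> n \<Longrightarrow> gap (n - k) (n - l) = gap k l"
  by linarith

lemma graceful_complement:
  assumes "graceful_labeling G f"
  shows "graceful_labeling G (\<lambda>v. m - f v)"
proof -
  have le: "f v \<le> m" if "v \<in> verts G" for v using assms that by (rule graceful_le)
  have "edge_label (\<lambda>v. m - f v) e = edge_label f e" if e: "e \<in> edges G" for e
  proof -
    obtain u v where "e = {u, v}" "u \<in> verts G" "v \<in> verts G" using edge_cases[OF e] by blast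
    then show ?thesis using gap_complement[OF le le] by (simp only: edge_label_doubleton)
  qed
  then have "inj_on (edge_label (\<lambda>v. m - f v)) (edges G)"
    using assms by (simp add: graceful_labeling_def cong: inj_on_cong)
  moreover have "inj_on (\<lambda>v. m - f v) (verts G)"
  proof (rule inj_onI)
    fix u v assume uv: "u \<in> verts G" "v \<in> verts G" "m - f u = m - f v"
    then have "f u = f v" using le[of u] le[of v] by linarith
    then show "u = v" using graceful_inj[OF assms] uv by blast
  qed
  ultimately show ?thesis unfolding graceful_labeling_def m_def by auto
qed

text \<open>The subtraction is truncated, so this is an involution only for values up to
  \<open>m\<close>; hence the range hypotheses below.\<close>

definition flip :: "('a \<rightharpoonup> nat) \<Rightarrow> 'a \<rightharpoonup> nat" where
  "flip p = (\<lambda>v. map_option (\<lambda>l. m - l) (p v))"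

lemma dom_flip [simp]: "dom (flip p) = dom p"
  by (auto simp: flip_def)

lemma flip_update: "flip (p(v \<mapsto> l)) = (flip p)(v \<mapsto> m - l)"
  by (auto simp: flip_def)

lemma flip_flip: "ran p \<subseteq> {..m} \<Longrightarrow> flip (flip p) = p"
proof
  fix v assume "ran p \<subseteq> {..m}"
  then show "flip (flip p) v = p v"
    by (cases "p v") (auto simp: flip_def dest: ranI)
qed

lemma ran_flip: "ran (flip p) \<subseteq> {..m}"
  by (auto simp: flip_def ran_def)

lemma ran_update_le: "ran p \<subseteq> {..m} \<Longrightarrow> l \<le> m \<Longrightarrow> ran (p(v \<mapsto> l)) \<subseteq> {..m}"
  by (auto simp: ran_def split: if_splits)

lemma consistent_flip:
  assumes "ran p \<subseteq> {..m}" and c: "consistent G p"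
  shows "consistent G (flip p)"
proof -
  have "edge_label (the \<circ> flip p) e = edge_label (the \<circ> p) e" if e: "e \<in> edges G" "e \<subseteq> dom p" for e
  proof -
    obtain u v where uv: "e = {u, v}" using edge_cases e by blast
    then obtain k l where "p u = Some k" "p v = Some l" using e by auto
    moreover from this have "k \<le> m" "l \<le> m" using assms by (auto dest: ranI)
    ultimately show ?thesis using uv gap_complement[of k m l]
      by (simp only: edge_label_doubleton flip_def comp_apply option.map option.sel)
  qed
  then show ?thesis
    using c unfolding consistent_def dom_flip by (auto simp: inj_on_def)
qed

lemma legal_flip:
  assumes p: "ran p \<subseteq> {..m}" and l: "legal G p v l"
  shows "legal G (flip p) v (m - l)"
proof -
  have lm: "l \<le> m" using l by (simp add: legal_def m_def)
  have "m - l \<notin> ran (flip p)"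
  proof
    assume "m - l \<in> ran (flip p)"
    then obtain u k where "p u = Some k" "m - k = m - l" by (auto simp: flip_def ran_def)
    moreover from this have "k \<le> m" using p by (auto dest: ranI)
    ultimately have "p u = Some l" using lm by auto
    then show False using l by (auto simp: legal_def dest: ranI)
  qed
  moreover have "consistent G ((flip p)(v \<mapsto> m - l))"
    using l consistent_flip[OF ran_update_le[OF p lm]] by (simp add: flip_update legal_def)
  ultimately show ?thesis using l by (auto simp: legal_def m_def)
qed

text \<open>Complementing keeps edge labels, hence legality and deadness. In the case
  \<open>alice\<close> a move in the complemented position is carried back by complementing once
  more.\<close>

lemma bob_wins_flip: "bob_wins G P p \<Longrightarrow> ran p \<subseteq> {..m} \<Longrightarrow> bob_wins G P (flip p)"
proof (induction rule: bob_wins.induct)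
  case (dead p P)
  note d = dead
  have "dead G (flip p)"
    unfolding dead_def
  proof (intro notI, elim exE conjE)
    fix f assume f: "graceful_labeling G f" "\<forall>v l. flip p v = Some l \<longrightarrow> f v = l"
    have "m - f v = l" if "p v = Some l" for v l
    proof -
      have "l \<le> m" using d that by (auto dest: ranI)
      then show ?thesis using f(2)[rule_format, of v "m - l"] that by (simp add: flip_def)
    qed
    then show False using graceful_complement[OF f(1)] d(1) unfolding dead_def by blast
  qed
  then show ?case by (rule bob_wins.dead)
next
  case (bob p v l)
  have "l \<le> m" using bob.hyps by (simp add: legal_def m_def)
  then have "bob_wins G Alice (flip (p(v \<mapsto> l)))"
    by (intro bob.IH ran_update_le bob.prems)
  then show ?case unfolding flip_update
    using legal_flip[OF bob.prems bob.hyps(1)] by (rule bob_wins.bob[rotated])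
next
  case (alice p)
  show ?case
  proof (rule bob_wins.alice)
    show "dom (flip p) \<noteq> verts G" using alice by simp
    fix v l assume l: "legal G (flip p) v l"
    then have lm: "l \<le> m" by (simp add: legal_def m_def)
    have "legal G p v (m - l)" using legal_flip[OF ran_flip l] flip_flip[OF alice.prems] by simp
    then have "bob_wins G Bob (flip (p(v \<mapsto> m - l)))"
      by (rule alice.IH) (intro ran_update_le alice.prems diff_le_self)
    then show "bob_wins G Bob ((flip p)(v \<mapsto> l))" using lm by (simp add: flip_update)
  qed
qed

section \<open>Dead positions: origins of the edge labels m, m - 1 and m - 2\<close>

lemma dead_zero_max:
  assumes "p u = Some 0" "p w = Some m" "\<not> adj G u w" "u \<in> verts G" "w \<in> verts G" "0 < m"
  shows "dead G p"
  unfolding dead_def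
proof (intro notI, elim exE conjE)
  fix f assume f: "graceful_labeling G f" "\<forall>v l. p v = Some l \<longrightarrow> f v = l"
  obtain x y where xy: "adj G x y" "f x = f y + m" using graceful_label_attained[OF f(1), of m] assms by auto
  then have v: "x \<in> verts G" "y \<in> verts G" using adj_verts by blast+
  have "f x = m" "f y = 0" using xy graceful_le[OF f(1) v(1)] by auto
  moreover have "f w = m" "f u = 0" using f(2) assms by auto
  ultimately have "x = w" "y = u" using assms v graceful_inj[OF f(1)] by metis+
  then show False using xy assms adj_commute by metis
qed

text \<open>
  If 0 has a neighbour labelled 1 and another one labelled neither m - 1 nor m, then m must go to
  the third neighbour, and no place is left that would produce the edge label m - 1.
\<close>

lemma dead_zero_one:
  assumes p: "p v = Some 0" "p b = Some 1" "p c = Some y" and y: "y \<noteq> m" "y \<noteq> m - 1"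
    and nbrs: "\<And>u. adj G v u \<longleftrightarrow> u = b \<or> u = c \<or> u = d" and bd: "\<not> adj G b d" and m: "3 \<le> m"
  shows "dead G p"
  unfolding dead_def
proof (intro notI, elim exE conjE)
  fix f assume f: "graceful_labeling G f" "\<forall>v l. p v = Some l \<longrightarrow> f v = l"
  have lab: "f v = 0" "f b = 1" "f c = y" using f(2) p by auto
  have V: "v \<in> verts G" "b \<in> verts G" "c \<in> verts G" "d \<in> verts G"
    using nbrs adj_verts by blast+
  note inj = graceful_inj[OF f(1)]
  obtain x w where xw: "adj G x w" "f x = f w + m"
    using graceful_label_attained[OF f(1), of m] m by auto
  then have "f x \<le> m" using graceful_le[OF f(1)] adj_verts by blast
  then have "f w = f v" "f x = m" using xw lab by auto
  then have "w = v" using inj xw(1) V adj_verts by blast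
  then have "x = b \<or> x = c \<or> x = d" using xw(1) nbrs adj_commute by metis
  then have d: "f d = m" using lab y m \<open>f x = m\<close> by auto
  have "1 \<le> m - 1" using m by simp
  then obtain x w where xw: "adj G x w" "f x = f w + (m - 1)"
    using graceful_label_attained[OF f(1) _ diff_le_self] by blast
  then have "f x \<le> m" using graceful_le[OF f(1)] adj_verts by blast
  \<comment> \<open>Within 0, ..., m the difference m - 1 arises only from the pairs 0, m - 1 and 1,
    m.\<close>
  then have "f w = f v \<and> f x = m - 1 \<or> f w = f b \<and> f x = f d" using xw lab m d by auto
  then show False
  proof
    assume *: "f w = f v \<and> f x = m - 1"
    then have "w = v" using inj xw(1) V adj_verts by blast
    then have "x = b \<or> x = c \<or> x = d" using xw(1) nbrs adj_commute by metis
    then show False using lab y m d * by auto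
  next
    assume "f w = f b \<and> f x = f d"
    then have "w = b" "x = d" using inj xw(1) V adj_verts by blast+
    then show False using xw(1) bd adj_commute by metis
  qed
qed

text \<open>The edge label m - 2 can come only from the pairs 0, m - 2 or 1, m - 1 or 2, m. The
  first fails because the neighbours of \<open>v\<close> carry 1, m - 1 and m, the others because
  the two vertices are not adjacent.\<close>

lemma dead_zero_full:
  assumes p: "p v = Some 0" "p b = Some 1" "p c = Some m" "p d = Some (m - 1)" "p e = Some 2"
    and nbrs: "\<And>u. adj G v u \<longleftrightarrow> u = b \<or> u = c \<or> u = d" and bd: "\<not> adj G b d"
    and ec: "\<not> adj G e c" "e \<in> verts G" and m: "4 \<le> m"
  shows "dead G p"
  unfolding dead_def
proof (intro notI, elim exE conjE)
  fix f assume f: "graceful_labeling G f" "\<forall>v l. p v = Some l \<longrightarrow> f v = l"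
  have lab: "f v = 0" "f b = 1" "f c = m" "f d = m - 1" "f e = 2" using f(2) p by auto
  have V: "v \<in> verts G" "b \<in> verts G" "c \<in> verts G" "d \<in> verts G"
    using nbrs adj_verts by blast+
  note inj = graceful_inj[OF f(1)]
  have "1 \<le> m - 2" using m by simp
  then obtain x w where xw: "adj G x w" "f x = f w + (m - 2)"
    using graceful_label_attained[OF f(1) _ diff_le_self] by blast
  then have "f x \<le> m" using graceful_le[OF f(1)] adj_verts by blast
  then have "f w = f v \<and> f x = m - 2 \<or> f w = f b \<and> f x = f d \<or> f w = f e \<and> f x = f c"
    using xw lab m by auto
  then show False
  proof (elim disjE)
    assume *: "f w = f v \<and> f x = m - 2"
    then have "w = v" using inj xw(1) V adj_verts by blast
    then have "x = b \<or> x = c \<or> x = d" using xw(1) nbrs adj_commute by metis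
    then show False using lab m * by auto
  next
    assume "f w = f b \<and> f x = f d"
    then have "w = b" "x = d" using inj xw(1) V adj_verts by blast+
    then show False using xw(1) bd adj_commute by metis
  next
    assume "f w = f e \<and> f x = f c"
    then have "w = e" "x = c" using inj xw(1) V ec adj_verts by blast+
    then show False using xw(1) ec adj_commute by metis
  qed
qed

lemma legal_consistent: "legal G p v l \<Longrightarrow> consistent G (p(v \<mapsto> l))"
  by (simp add: legal_def)

lemma consistent_singleton: "consistent G [v \<mapsto> l]"
  unfolding consistent_def
proof (rule inj_onI; elim CollectE conjE)
  fix e e' assume "e \<in> edges G" "e \<subseteq> dom [v \<mapsto> l]"
  then show "e = e'" using edge_cases[of e] by (auto simp: doubleton_eq_iff)
qed

lemma legal_empty: "v \<in> verts G \<Longrightarrow> l \<le> m \<Longrightarrow> legal G Map.empty v l"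
  using consistent_singleton by (simp add: legal_def m_def)

lemma legal_singleton:
  assumes "u \<in> verts G" "w \<in> verts G" "u \<noteq> w" "k \<le> m" "l \<le> m" "k \<noteq> l"
  shows "legal G [u \<mapsto> k] w l"
  by (rule legalI) (use assms consistent_singleton adj_irrefl in \<open>auto split: if_splits\<close>)

end

text \<open>Supplies a label for the last neighbour of \<open>v\<close> once 0, \<open>m\<close>, 1
  and \<open>j\<close> are placed. The set holds the edge labels that may be present, and m - 1,
  which \<open>dead_zero_one\<close> forbids as a vertex label. As t is at most 10 and m at least
  12, t stays below m - 1.\<close>

lemma fresh_label:
  fixes m j :: nat
  assumes m: "12 \<le> m" and j: "1 < j" "j < m"
  shows "\<exists>t. 2 \<le> t \<and> t \<le> 10 \<and> t \<noteq> j \<and> t \<notin> {m, 1, m - 1, m - j, j - 1} \<and>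
    gap t j \<notin> {t, m, 1, m - 1, m - j, j - 1}"
proof -
  \<comment> \<open>Nine candidates face at most seven bad values. The first three repeat j or give
    the difference 1, m - j is an edge label, and the last three are where the difference to j could
    be m - j, j - 1 or t itself.\<close>
  let ?B = "[j, j - 1, j + 1, m - j, 2 * j - m, 2 * j - 1, j div 2]"
  have "\<exists>t\<in>{2..10}. t \<notin> set ?B"
  proof (rule ccontr)
    assume "\<not> ?thesis"
    then have "card {2..10::nat} \<le> card (set ?B)"
      by (intro card_mono) auto
    also have "\<dots> \<le> 7" by (rule order_trans[OF card_length]) simp
    finally show False by simp
  qed
  then obtain t where t: "2 \<le> t" "t \<le> 10" and B: "t \<notin> set ?B" by auto
  have "t \<noteq> j" "t + 1 \<noteq> j" "t \<noteq> j + 1" "t + j \<noteq> m" "t + m \<noteq> 2 * j" "t + 1 \<noteq> 2 * j" "j \<noteq> 2 * t"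
    using B unfolding list.set insert_iff by auto
  note b = this
  have "t \<notin> {m, 1, m - 1, m - j, j - 1}" using b t m j by auto
  moreover have "gap t j \<notin> {t, m, 1, m - 1, m - j, j - 1}"
  proof (cases "t \<le> j")
    case True
    then have "gap t j = j - t" by linarith
    then show ?thesis using True t b m j by auto
  next
    case False
    then have "gap t j = t - j" by linarith
    then show ?thesis using False t b m j by auto
  qed
  ultimately show ?thesis using t b(1) by blast
qed

section \<open>The game around a vertex of a prism with r > 3\<close>

text \<open>
  In a prism with r > 3, take v = (i, s) and let a be its partner in the other cycle; n1 and n2 are
  the neighbours of v in its own cycle, z = (i + 2, s), and z' is the partner of z. The vertex z is
  a common neighbour of n1 and n2 in the cube only, where m = 12.
\<close>

locale star = simple_graph G m for G :: "'a graph" and m +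
  fixes v a n1 n2 z z' :: 'a
  assumes m12: "12 \<le> m"
    and nbrs: "adj G v u \<longleftrightarrow> u = a \<or> u = n1 \<or> u = n2"
    and dist: "distinct [v, a, n1, n2, z, z']"
    and z_verts: "z \<in> verts G" "z' \<in> verts G"
    and nonadj_nbrs: "\<not> adj G a n1" "\<not> adj G a n2" "\<not> adj G n1 n2"
    and nonadj_z: "\<not> adj G z a"
    and nonadj_z': "\<not> adj G z' a" "\<not> adj G z' n1" "\<not> adj G z' n2"
    and common: "adj G x n1 \<Longrightarrow> adj G x n2 \<Longrightarrow> x = v \<or> x = z \<and> m = 12"
    and a_far: "adj G x a \<Longrightarrow> x \<noteq> v \<Longrightarrow> \<not> adj G x z"
begin

lemma nbrs': "adj G u v \<longleftrightarrow> u = a \<or> u = n1 \<or> u = n2"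
  using nbrs adj_commute by metis

lemmas nonadj = nonadj_nbrs nonadj_z nonadj_z'
  nonadj_nbrs[THEN not_adj_sym] nonadj_z[THEN not_adj_sym] nonadj_z'[THEN not_adj_sym]

lemma in_verts: "v \<in> verts G" "a \<in> verts G" "n1 \<in> verts G" "n2 \<in> verts G"
  using nbrs adj_verts by blast+

lemma distinct_pairs:
  "v \<noteq> a" "v \<noteq> n1" "v \<noteq> n2" "v \<noteq> z" "v \<noteq> z'" "a \<noteq> n1" "a \<noteq> n2" "a \<noteq> z" "a \<noteq> z'"
  "n1 \<noteq> n2" "n1 \<noteq> z" "n1 \<noteq> z'" "n2 \<noteq> z" "n2 \<noteq> z'" "z \<noteq> z'"
  using dist by auto

lemmas star_simps = nbrs nbrs' nonadj adj_irrefl in_verts z_verts distinct_pairs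
  distinct_pairs[symmetric]

lemma bob_wins_Alice_first_zero: "bob_wins G Bob [a \<mapsto> 0]"
proof -
  have "legal G [a \<mapsto> 0] z m" using legal_singleton[of a z 0 m] star_simps m12 by auto
  moreover have "dead G [a \<mapsto> 0, z \<mapsto> m]"
    by (rule dead_zero_max[of _ a z]) (use star_simps m12 in auto)
  ultimately show ?thesis by (rule bob_wins.bob[OF _ bob_wins.dead])
qed

lemma bob_wins_max:
  assumes "legal G p u m" "\<not> adj G v u" "p v = Some 0" 
  shows "bob_wins G Bob p"
proof -
  have "dead G (p(u \<mapsto> m))"
    by (rule dead_zero_max[of _ v u]) (use assms m12 in_verts in \<open>auto simp: legal_def\<close>)
  then show ?thesis by (rule bob_wins.bob[OF assms(1) bob_wins.dead])
qed

lemma nbrs_nonadj: "adj G v b \<Longrightarrow> adj G v c \<Longrightarrow> \<not> adj G b c"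
  unfolding nbrs using nonadj adj_irrefl by auto

lemma nbrs_z': "adj G v b \<Longrightarrow> \<not> adj G z' b \<and> z' \<noteq> b \<and> v \<noteq> b"
  unfolding nbrs using nonadj dist by auto

text \<open>Whichever two neighbours of \<open>v\<close> carry 1 and \<open>y\<close>, the remaining
  one serves as \<open>d\<close> in \<open>dead_zero_one\<close>.\<close>

lemma dead_star:
  assumes p: "p v = Some 0" and bc: "b \<in> {a, n1, n2}" "c \<in> {a, n1, n2}"
    and lab: "p b = Some 1" "p c = Some y" "y \<noteq> 1" "y < m - 1"
  shows "dead G p"
proof -
  have "b \<noteq> c" using lab by auto
  then have "\<exists>d. (\<forall>u. adj G v u \<longleftrightarrow> u = b \<or> u = c \<or> u = d) \<and> \<not> adj G b d"
    using bc dist nonadj unfolding nbrs by (elim insertE emptyE) blast+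
  then obtain d where "\<And>u. adj G v u \<longleftrightarrow> u = b \<or> u = c \<or> u = d" "\<not> adj G b d" by blast
  then show ?thesis
    by (intro dead_zero_one[of p v b c y d]) (use p lab m12 in auto)
qed

text \<open>Bob wants to label \<open>n1\<close> or \<open>n2\<close> without creating an edge to
  \<open>x\<close>. If \<open>x\<close> is one of them, the other will do; otherwise
  \<open>x\<close> touches both, and \<open>common\<close> leaves only \<open>z\<close> in the
  cube.\<close>

lemma no_remote_nbr:
  assumes "x \<noteq> v" "\<nexists>n. n \<in> {n1, n2} \<and> n \<noteq> x \<and> \<not> adj G n x"
  shows "x = z" "m = 12"
proof -
  have "n1 \<noteq> n2" using dist by auto
  then have "x \<noteq> n1" "x \<noteq> n2" using assms nonadj by auto
  then have "adj G x n1" "adj G x n2" using assms adj_commute by (metis insertCI)+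
  then show "x = z" "m = 12" using common assms by blast+
qed

section \<open>Alice opens on \<open>a\<close>, Bob answers at \<open>v\<close>\<close>

lemma bob_wins_third_one:
  assumes "legal G [a \<mapsto> 1, v \<mapsto> 0] x k"
  shows "bob_wins G Bob [a \<mapsto> 1, v \<mapsto> 0, x \<mapsto> k]"
proof -
  let ?p = "[a \<mapsto> 1, v \<mapsto> 0, x \<mapsto> k]"
  have x: "x \<in> verts G" "x \<noteq> a" "x \<noteq> v" "k \<le> m" "k \<noteq> 0" "k \<noteq> 1"
    using assms dist by (auto simp: legal_def m_def split: if_splits)
  have c: "consistent G ?p" using assms by (rule legal_consistent)
  \<comment> \<open>As \<open>a\<close> carries 1, a label strictly between 1 and m - 1 on another
    neighbour of \<open>v\<close> kills the position.\<close>
  have "\<exists>n y. n \<in> {n1, n2} \<and> 1 < y \<and> y < m - 1 \<and> legal G ?p n y"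
  proof (cases "\<exists>n. n \<in> {n1, n2} \<and> n \<noteq> x \<and> \<not> adj G n x")
    case True
    then obtain n where n: "n \<in> {n1, n2}" "n \<noteq> x" "\<not> adj G n x" by blast
    \<comment> \<open>The only new edge goes to \<open>v\<close> and gets label y. It must avoid 1
      and possibly k or k - 1, so three candidates suffice.\<close>
    have "\<exists>y. 2 \<le> y \<and> y \<le> 4 \<and> y \<noteq> k \<and> y + 1 \<noteq> k"
      by presburger
    then obtain y where y: "2 \<le> y" "y \<le> 4" "y \<noteq> k" "y + 1 \<noteq> k" by blast
    have "legal G ?p n y"
      by (rule legalI) (use n y x c m12 n(3)[THEN not_adj_sym] in \<open>auto simp: star_simps split: if_splits\<close>)
    then show ?thesis using n y m12 by (intro exI[of _ n] exI[of _ y]) auto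
  next
    case False
    then have xz: "x = z" using no_remote_nbr x by blast
    \<comment> \<open>Now \<open>n1\<close> touches \<open>x\<close> as well; the difference of y
      and k must be neither 0 nor 1 nor y. This excludes at most four of five candidates.\<close>
    have "\<exists>y. 2 \<le> y \<and> y \<le> 6 \<and> y \<noteq> k \<and> y + 1 \<noteq> k \<and> y \<noteq> k + 1 \<and> 2 * y \<noteq> k"
      by presburger
    then obtain y where y: "2 \<le> y" "y \<le> 6" "y \<noteq> k" "y + 1 \<noteq> k" "y \<noteq> k + 1" "2 * y \<noteq> k" by blast
    have "legal G ?p n1 y"
      by (rule legalI) (use y x xz c m12 in \<open>auto simp: star_simps split: if_splits\<close>)
    then show ?thesis using y m12 by (intro exI[of _ n1] exI[of _ y]) auto
  qed
  then obtain n y where n: "n \<in> {n1, n2}" "1 < y" "y < m - 1" and l: "legal G ?p n y" by blast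
  have "n \<noteq> x" using l by (auto simp: legal_def)
  have "dead G (?p(n \<mapsto> y))"
    by (rule dead_star[of _ a n y]) (use n x \<open>n \<noteq> x\<close> dist in auto)
  then show ?thesis by (rule bob_wins.bob[OF l bob_wins.dead])
qed

text \<open>Bob has two threats: 1 beside \<open>v\<close> kills because \<open>a\<close> carries
  \<open>l\<close>, and m on \<open>z\<close> or \<open>z'\<close> kills because neither is adjacent
  to \<open>v\<close>. Unless the position is dead already, Alice's one move cannot stop
  both.\<close>

lemma bob_wins_third_large:
  assumes leg: "legal G [a \<mapsto> l, v \<mapsto> 0] x k" and l: "2 \<le> l" "2 * l \<le> m"
  shows "bob_wins G Bob [a \<mapsto> l, v \<mapsto> 0, x \<mapsto> k]"
proof -
  let ?p = "[a \<mapsto> l, v \<mapsto> 0, x \<mapsto> k]"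
  have x: "x \<in> verts G" "x \<noteq> a" "x \<noteq> v" "k \<le> m" "k \<noteq> 0" "k \<noteq> l"
    using leg dist by (auto simp: legal_def m_def split: if_splits)
  have c: "consistent G ?p" using leg by (rule legal_consistent)
  have max: "bob_wins G Bob ?p" if "legal G ?p u m" "u \<in> {z, z'}" for u
    by (rule bob_wins_max[OF that(1)]) (use that(2) x star_simps in auto)
  have one: "bob_wins G Bob ?p" if L: "legal G ?p n 1" and n: "n \<in> {n1, n2}" for n
  proof (rule bob_wins.bob[OF L bob_wins.dead])
    have "n \<noteq> x" using L by (auto simp: legal_def)
    then show "dead G (?p(n \<mapsto> 1))"
      by (intro dead_star[of _ n a l]) (use n x dist l m12 in auto)
  qed
  show ?thesis
  proof (cases "k = 1")
    case True
    show ?thesis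
    proof (cases "adj G v x")
      case True
      have "dead G ?p"
        by (rule dead_star[of _ x a l]) (use True \<open>k = 1\<close> x nbrs dist l m12 in auto)
      then show ?thesis by (rule bob_wins.dead)
    next
      case False
      obtain u where u: "u \<in> {z, z'}" "u \<noteq> x" using dist by auto
      have "legal G ?p u m"
        by (rule legalI)
          (use False False[THEN not_adj_sym] u \<open>k = 1\<close> x c l m12 in \<open>auto simp: star_simps split: if_splits\<close>)
      then show ?thesis using max u by blast
    qed
  next
    case False
    note k1 = False
    show ?thesis
    proof (cases "k = m")
      case True
      show ?thesis
      proof (cases "adj G v x")
        case True
        then obtain n where n: "n \<in> {n1, n2}" "n \<noteq> x" "\<not> adj G n x" "x \<in> {n1, n2}"
          using x nbrs dist nonadj by auto
        have "legal G ?p n 1"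
          by (rule legalI)
            (use n n(3)[THEN not_adj_sym] k1 x c l m12 in \<open>auto simp: star_simps split: if_splits\<close>)
        then show ?thesis using one n by blast
      next
        case False
        have "dead G ?p"
          by (rule dead_zero_max[of _ v x]) (use False \<open>k = m\<close> x in_verts dist m12 in auto)
        then show ?thesis by (rule bob_wins.dead)
      qed
    next
      case km: False
      consider (near) "adj G x a" "gap l k = 1" 
        | (remote) n where "n \<in> {n1, n2}" "n \<noteq> x" "\<not> adj G n x" "adj G x a \<longrightarrow> gap l k \<noteq> 1"
        | (opposite) "x = z" "m = 12"
        using no_remote_nbr x(3) by blast
      then show ?thesis
      proof cases
        case near
        \<comment> \<open>The edge from \<open>x\<close> to \<open>a\<close> already uses the label
          1. By \<open>a_far\<close>, m on \<open>z\<close> creates no new edge.\<close>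
        have "\<not> adj G x z" "x \<noteq> z" using a_far near x nonadj by auto
        then have "legal G ?p z m"
          by (intro legalI)
            (use not_adj_sym[of G x z] km x c m12 l in \<open>auto simp: star_simps split: if_splits\<close>)
        then show ?thesis using max by blast
      next
        case remote
        have "legal G ?p n 1"
          by (rule legalI)
            (use remote remote(3)[THEN not_adj_sym] remote(4)[unfolded adj_commute[of G x a]]
              k1 x c l m12 in \<open>auto simp: star_simps split: if_splits\<close>)
        then show ?thesis using one remote by blast
      next
        case opposite
        show ?thesis
        proof (cases "k = 2 \<or> k = l + 1")
          case True
          \<comment> \<open>Here 1 on \<open>n1\<close> would give the edge to \<open>z\<close> the
            label k - 1, equal to 1 or l. So m goes to \<open>z'\<close>; a possible edge to
            \<open>z\<close> has label m - k, which is not l: k = 2 would need l = 10 > m / 2, and k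
            = l + 1 would need 2 l + 1 = 12.\<close>
          have "k + l \<noteq> m" using True l opposite(2) by presburger
          then have "legal G ?p z' m"
            by (intro legalI)
              (use opposite km x c l m12 in \<open>auto simp: star_simps split: if_splits\<close>)
          then show ?thesis using max by blast
        next
          case False
          have "legal G ?p n1 1"
            by (rule legalI)
              (use opposite False k1 x c l m12 in \<open>auto simp: star_simps split: if_splits\<close>)
          then show ?thesis using one by blast
        qed
      qed
    qed
  qed
qed

lemma bob_wins_Alice_first:
  assumes l: "l \<le> m"
  shows "bob_wins G Bob [a \<mapsto> l]"
proof -
  have small: "bob_wins G Bob [a \<mapsto> l]" if l: "2 * l \<le> m" for l
  proof (cases "l = 0")
    case True
    then show ?thesis using bob_wins_Alice_first_zero by simp
  next
    case False
    have L: "legal G [a \<mapsto> l] v 0"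
      by (rule legal_singleton) (use False l in_verts dist in auto)
    show ?thesis
    proof (rule bob_wins.bob[OF L bob_wins.alice])
      show "dom [a \<mapsto> l, v \<mapsto> 0] \<noteq> verts G" using z_verts dist by auto
      fix x k assume "legal G [a \<mapsto> l, v \<mapsto> 0] x k"
      then show "bob_wins G Bob [a \<mapsto> l, v \<mapsto> 0, x \<mapsto> k]"
        using bob_wins_third_one bob_wins_third_large[of l x k] l False by (cases "l = 1") auto
    qed
  qed
  show ?thesis
  proof (cases "2 * l \<le> m")
    case False
    then have "bob_wins G Bob (flip [a \<mapsto> m - l])"
      by (intro bob_wins_flip small) auto
    then show ?thesis using l by (simp add: flip_def fun_upd_def if_distrib cong: if_cong)
  qed (rule small)
qed

section \<open>Bob opens with 0 on \<open>v\<close>\<close>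

lemma bob_wins_fifth:
  assumes leg: "legal G [v \<mapsto> 0, w \<mapsto> m, n \<mapsto> 1] y j" and w: "{w, n, n'} = {a, n1, n2}" "distinct [w, n, n']"
  shows "bob_wins G Bob [v \<mapsto> 0, w \<mapsto> m, n \<mapsto> 1, y \<mapsto> j]"
proof -
  let ?p = "[v \<mapsto> 0, w \<mapsto> m, n \<mapsto> 1, y \<mapsto> j]"
  have nb: "adj G v u \<longleftrightarrow> u = w \<or> u = n \<or> u = n'" for u
    using w(1) nbrs by auto
  have nb': "adj G u v \<longleftrightarrow> u = w \<or> u = n \<or> u = n'" for u
    using nb adj_commute by metis
  have ne: "z' \<noteq> v" "z' \<noteq> w" "z' \<noteq> n" "z' \<noteq> n'" "v \<noteq> w" "v \<noteq> n" "v \<noteq> n'"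
    using dist nbrs_z' nb by auto
  have na: "\<not> adj G w n" "\<not> adj G w n'" "\<not> adj G n n'" "\<not> adj G z' w" "\<not> adj G z' n" "\<not> adj G z' n'"
    using nbrs_z' nbrs_nonadj nb by blast+
  have wn: "w \<noteq> n" "w \<noteq> n'" "n \<noteq> n'" using w(2) by auto
  note na' = na na[THEN not_adj_sym] nb nb' ne ne[symmetric] wn wn[symmetric] adj_irrefl
    z_verts in_verts
  have V: "w \<in> verts G" "n \<in> verts G" "n' \<in> verts G" using nb adj_verts by blast+
  have y: "y \<in> verts G" "y \<noteq> v" "y \<noteq> w" "y \<noteq> n" "j \<le> m" "j \<noteq> 0" "j \<noteq> 1" "j \<noteq> m"
    using leg ne w(2) m12 by (auto simp: legal_def m_def split: if_splits)
  have c: "consistent G ?p" using leg by (rule legal_consistent)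
  show ?thesis
  proof (cases "y = n'")
    case yn: True
    show ?thesis
    proof (cases "j = m - 1")
      case True
      \<comment> \<open>\<open>z'\<close> touches neither \<open>v\<close> nor a neighbour of
        \<open>v\<close>, so this move creates no edge.\<close>
      have L: "legal G ?p z' 2"
        by (rule legalI) (use yn True c m12 in \<open>auto simp: na' split: if_splits\<close>)
      have "dead G (?p(z' \<mapsto> 2))"
        by (rule dead_zero_full[of _ v n w n' z']) (use yn True m12 in \<open>auto simp: na'\<close>)
      then show ?thesis by (rule bob_wins.bob[OF L bob_wins.dead])
    next
      case False
      have "dead G ?p"
        by (rule dead_zero_one[of _ v n n' j w]) (use yn False y m12 in \<open>auto simp: na'\<close>)
      then show ?thesis by (rule bob_wins.dead)
    qed
  next
    case yn: False
    \<comment> \<open>Alice left \<open>n'\<close> free; Bob takes it with a label other than m - 1.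
      Among labeled vertices only \<open>v\<close> and possibly \<open>y\<close> touch
      \<open>n'\<close>.\<close>
    have "1 < j" "j < m" using y by auto
    then obtain t where t: "2 \<le> t" "t \<le> 10" "t \<noteq> j" "t \<notin> {m, 1, m - 1, m - j, j - 1}"
      "gap t j \<notin> {t, m, 1, m - 1, m - j, j - 1}"
      using fresh_label[OF m12] by blast
    have lab: "x = v \<and> gap t k = t \<or> x = y \<and> gap t k = gap t j" if "adj G n' x" "?p x = Some k" for x k
      using that yn y by (auto simp: na' simp del: nat_minus_as_int split: if_splits)
    have L: "legal G ?p n' t"
    proof (rule legalI)
      show "gap t k \<noteq> gap t k'"
        if "adj G n' x" "?p x = Some k" "adj G n' x'" "?p x' = Some k'" "x \<noteq> x'" for x k x' k'
        using lab[OF that(1,2)] lab[OF that(3,4)] that(5) t(5) by auto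
      show "gap t k \<noteq> k2 - k1" if "adj G n' x" "?p x = Some k" "adj G x1 x2" "?p x1 = Some k1"
        "?p x2 = Some k2" "k1 \<le> k2" for x k x1 k1 x2 k2
      proof -
        have "k2 - k1 \<in> {m, 1, m - 1, m - j, j - 1}"
          using that(3-) yn y m12 by (auto simp: na' split: if_splits)
        then show ?thesis using lab[OF that(1,2)] t(4,5) by (metis insertCI)
      qed
    qed (use V yn c t(1-3) y ne w(2) m12 in auto)
    have "dead G (?p(n' \<mapsto> t))"
      by (rule dead_zero_one[of _ v n n' t w]) (use yn t(4) y m12 in \<open>auto simp: na'\<close>)
    then show ?thesis by (rule bob_wins.bob[OF L bob_wins.dead])
  qed
qed

lemma bob_wins_third_Bob_first:
  assumes leg: "legal G [v \<mapsto> 0] x k"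
  shows "bob_wins G Bob [v \<mapsto> 0, x \<mapsto> k]"
proof -
  let ?p = "[v \<mapsto> 0, x \<mapsto> k]"
  have x: "x \<in> verts G" "x \<noteq> v" "k \<le> m" "k \<noteq> 0"
    using leg by (auto simp: legal_def m_def split: if_splits)
  have c: "consistent G ?p" using leg by (rule legal_consistent)
  show ?thesis
  proof (cases "k = m")
    case km: True
    show ?thesis
    proof (cases "adj G v x")
      case True
      then have "\<exists>n n'. {x, n, n'} = {a, n1, n2} \<and> distinct [x, n, n']"
        using nbrs dist by auto
      then obtain n n' where n: "{x, n, n'} = {a, n1, n2}" "distinct [x, n, n']" by blast
      then have nx: "n \<in> {a, n1, n2}" by blast
      then have nx': "\<not> adj G n x" using True nbrs_nonadj[of n x] by (auto simp: nbrs)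
      have L: "legal G ?p n 1"
        by (rule legalI)
          (use nx nx' nx'[THEN not_adj_sym] n(2) x km c m12 in \<open>auto simp: star_simps split: if_splits\<close>)
      show ?thesis
      proof (rule bob_wins.bob[OF L bob_wins.alice])
        have "z \<notin> dom (?p(n \<mapsto> 1))" using nx True distinct_pairs unfolding nbrs by auto
        then show "dom (?p(n \<mapsto> 1)) \<noteq> verts G" using z_verts by metis
        show "bob_wins G Bob (?p(n \<mapsto> 1, y \<mapsto> j))" if "legal G (?p(n \<mapsto> 1)) y j" for y j
          unfolding km by (rule bob_wins_fifth[OF that[unfolded km] n])
      qed
    next
      case False
      have "dead G ?p"
        by (rule dead_zero_max[of _ v x]) (use False km x in_verts m12 in auto)
      then show ?thesis by (rule bob_wins.dead)
    qed
  next
    case False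
    \<comment> \<open>\<open>z'\<close> is preferred since it touches no neighbour of
      \<open>v\<close>: either way at most one edge is fully labeled afterwards.\<close>
    obtain u where u: "u \<in> {z, z'}" "u \<noteq> x" "x = z' \<or> u = z'" using dist by auto
    have "legal G ?p u m"
      by (rule legalI) (use u False x c m12 in \<open>auto simp: star_simps split: if_splits\<close>)
    then show ?thesis by (rule bob_wins_max) (use u x star_simps in auto)
  qed
qed

lemma bob_wins_Bob_first: "bob_wins G Bob Map.empty"
proof (rule bob_wins.bob[OF legal_empty bob_wins.alice])
  show "dom [v \<mapsto> 0] \<noteq> verts G" using z_verts dist by auto
  show "bob_wins G Bob [v \<mapsto> 0, x \<mapsto> k]" if "legal G [v \<mapsto> 0] x k" for x k
    using that by (rule bob_wins_third_Bob_first)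
qed (use in_verts in auto)

end

section \<open>Prisms\<close>

text \<open>The case split replaces \<open>mod\<close>, so that later facts are linear
  arithmetic.\<close>

definition nxt :: "nat \<Rightarrow> nat \<Rightarrow> nat" where
  "nxt r i = (if Suc i = r then 0 else Suc i)"

lemma nxt_mod: "i < r \<Longrightarrow> (i + 1) mod r = nxt r i"
  by (auto simp: nxt_def)

lemma nxt_less: "i < r \<Longrightarrow> nxt r i < r"
  by (auto simp: nxt_def)

lemma verts_prism: "verts (prism r) = {..<r} \<times> {..<2}"
  by (simp add: prism_def cartesian_product_def cycle_graph_def path_graph_def)

lemma edges_prism:
  "edges (prism r) = (\<lambda>(i, s). {(i, s), (nxt r i, s)}) ` ({..<r} \<times> {..<2}) \<union>
     (\<lambda>i. {(i, 0), (i, 1)}) ` {..<r}" (is "_ = ?A \<union> ?B")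
proof -
  have c: "edges (cycle_graph r) = {{i, nxt r i} | i. i < r}"
    by (auto simp: cycle_graph_def nxt_mod[unfolded Suc_eq_plus1[symmetric]] )
  have p: "edges (path_graph 2) = {{0, 1}}" by (auto simp: path_graph_def)
  have v: "verts (cycle_graph r) = {..<r}" "verts (path_graph 2) = {..<2}"
    by (auto simp: cycle_graph_def path_graph_def)
  have "{{(u, x), (v, x)} | u v x. {u, v} \<in> edges (cycle_graph r) \<and> x \<in> verts (path_graph 2)} = ?A"
  proof (intro set_eqI iffI)
    fix e assume "e \<in> {{(u, x), (v, x)} | u v x. {u, v} \<in> edges (cycle_graph r) \<and> x \<in> verts (path_graph 2)}"
    then obtain u w x i where "e = {(u, x), (w, x)}" "{u, w} = {i, nxt r i}" "i < r" "x < 2"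
      unfolding c v by auto
    then show "e \<in> ?A" by (auto simp: doubleton_eq_iff insert_commute intro!: image_eqI[of _ _ "(i, x)"])
  next
    fix e assume "e \<in> ?A"
    then show "e \<in> {{(u, x), (v, x)} | u v x. {u, v} \<in> edges (cycle_graph r) \<and> x \<in> verts (path_graph 2)}"
      unfolding c v by auto
  qed
  moreover have "{{(u, x), (u, y)} | u x y. u \<in> verts (cycle_graph r) \<and> {x, y} \<in> edges (path_graph 2)} = ?B"
    unfolding p v by (auto simp: doubleton_eq_iff insert_commute)
  ultimately show ?thesis by (simp add: prism_def cartesian_product_def)
qed

lemma adj_prism:
  "adj (prism r) (i, s) (j, t) \<longleftrightarrow> i < r \<and> j < r \<and> s < 2 \<and> t < 2 \<and>
     (s = t \<and> (j = nxt r i \<or> i = nxt r j) \<or> i = j \<and> s \<noteq> t)"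
proof -
  have A: "{(i, s), (j, t)} \<in> (\<lambda>(i, s). {(i, s), (nxt r i, s)}) ` ({..<r} \<times> {..<2}) \<longleftrightarrow>
      s = t \<and> s < 2 \<and> (i < r \<and> j = nxt r i \<or> j < r \<and> i = nxt r j)"
    by (simp add: image_iff Bex_def split_paired_Ex doubleton_eq_iff) blast
  have B: "{(i, s), (j, t)} \<in> (\<lambda>i. {(i, 0), (i, 1)}) ` {..<r} \<longleftrightarrow>
      i = j \<and> i < r \<and> (s = 0 \<and> t = 1 \<or> s = 1 \<and> t = 0)"
    by (simp add: image_iff Bex_def doubleton_eq_iff) blast
  have "s < 2 \<and> t < 2 \<and> s \<noteq> t \<longleftrightarrow> s = 0 \<and> t = 1 \<or> s = 1 \<and> t = 0" by linarith
  then show ?thesis unfolding adj_def edges_prism Un_iff A B using nxt_less by blast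
qed

text \<open>For r at least 3 the 2 r cycle edges are distinct (for r = 2 the two directions
  coincide). They differ from the r edges between partners since their ends share the second
  coordinate.\<close>

lemma card_edges_prism:
  assumes "3 \<le> r"
  shows "card (edges (prism r)) = 3 * r"
proof -
  have "inj_on (\<lambda>(i, s). {(i, s), (nxt r i, s)}) ({..<r} \<times> {..<2::nat})"
    using assms by (auto simp: inj_on_def doubleton_eq_iff nxt_def split: if_splits)
  moreover have "inj_on (\<lambda>i. {(i, 0 :: nat), (i, 1)}) {..<r}"
    by (auto simp: inj_on_def doubleton_eq_iff)
  moreover have "(\<lambda>(i, s). {(i, s), (nxt r i, s)}) ` ({..<r} \<times> {..<2::nat}) \<inter>
      (\<lambda>i. {(i, 0 :: nat), (i, 1)}) ` {..<r} = {}"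
  proof (intro equals0I, elim IntE imageE)
    fix e x i assume e: "e = (case x of (i, s) \<Rightarrow> {(i, s), (nxt r i, s)})" "e = {(i, 0 :: nat), (i, 1)}"
    have "snd ` e = {snd x}" unfolding e(1) by (simp split: prod.splits)
    moreover have "snd ` e = {0, 1}" unfolding e(2) by simp
    ultimately have "{snd x} = {0, 1}" by simp
    then show False by auto
  qed
  ultimately show ?thesis
    unfolding edges_prism by (subst card_Un_disjoint) (auto simp: card_image)
qed

lemma simple_prism:
  assumes "3 \<le> r"
  shows "simple_graph (prism r)"
proof
  show "finite (edges (prism r))" by (simp add: edges_prism)
  show "\<exists>u v. e = {u, v} \<and> u \<noteq> v \<and> u \<in> verts (prism r) \<and> v \<in> verts (prism r)"
    if "e \<in> edges (prism r)" for e
  proof -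
    from that consider i s where "i < r" "s < 2" "e = {(i, s), (nxt r i, s)}"
      | i where "i < r" "e = {(i, 0), (i, 1)}"
      unfolding edges_prism by blast
    then show ?thesis
    proof cases
      case (1 i s)
      then have "nxt r i \<noteq> i" using assms by (auto simp: nxt_def)
      then show ?thesis unfolding verts_prism using 1 nxt_less[of i r]
        by (rule_tac exI[of _ "(i, s)"], rule_tac exI[of _ "(nxt r i, s)"]) simp
    next
      case (2 i)
      then show ?thesis unfolding verts_prism
        by (rule_tac exI[of _ "(i, 0)"], rule_tac exI[of _ "(i, 1)"]) simp
    qed
  qed
qed

text \<open>The centre \<open>v\<close> is the partner of \<open>a\<close>. On the cycle
  \<open>pv\<close>, \<open>i\<close>, \<open>n\<close>, \<open>i2\<close> are consecutive, and they
  are distinct because r is at least 4.\<close>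

lemma prism_star:
  assumes r: "4 \<le> r" and a: "a \<in> verts (prism r)"
  shows "\<exists>v n1 n2 z z'. star (prism r) v a n1 n2 z z'"
proof -
  obtain i s where as: "a = (i, s)" "i < r" "s < 2" using a by (auto simp: verts_prism)
  define pv where "pv = (if i = 0 then r - 1 else i - 1)"
  define n where "n = nxt r i"
  define i2 where "i2 = nxt r n"
  define t where "t = 1 - s"
  have t: "t < 2" "s \<noteq> t" "\<And>u. u < 2 \<Longrightarrow> u = s \<or> u = t"
    using as(3) by (auto simp: t_def less_2_cases_iff)
  have lt: "pv < r" "n < r" "i2 < r" using as r nxt_less by (auto simp: pv_def n_def i2_def)
  have nx: "nxt r j = n \<longleftrightarrow> j = i" "nxt r j = i \<longleftrightarrow> j = pv" "nxt r j = i2 \<longleftrightarrow> j = n" if "j < r" for j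
    using that as r by (auto simp: nxt_def n_def i2_def pv_def split: if_splits)
  have eqs: "nxt r i = n" "nxt r pv = i" "nxt r n = i2" using nx lt as by auto
  have ne: "n \<noteq> i" "pv \<noteq> i" "i2 \<noteq> i" "pv \<noteq> n" "i2 \<noteq> n" "i2 \<noteq> pv"
    using as r by (auto simp: nxt_def n_def i2_def pv_def split: if_splits)
  \<comment> \<open>The cycle closes up right after \<open>i2\<close> only in the cube, where
    \<open>(i2, t)\<close> touches both \<open>(n, t)\<close> and \<open>(pv, t)\<close>.\<close>
  have r4: "nxt r i2 = pv \<longleftrightarrow> r = 4" "nxt r i2 \<noteq> i" "nxt r i2 \<noteq> n"
    using as r by (auto simp: nxt_def n_def i2_def pv_def split: if_splits)
  have m: "card (edges (prism r)) = 3 * r" using card_edges_prism r by simp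
  have "star (prism r) (i, t) a (n, t) (pv, t) (i2, t) (i2, s)"
    unfolding as(1)
  proof (intro star.intro star_axioms.intro simple_prism)
    show "3 \<le> r" "12 \<le> card (edges (prism r))" using r m by auto
    show "distinct [(i, t), (i, s), (n, t), (pv, t), (i2, t), (i2, s)]"
      using t ne by auto
    show "(i2, t) \<in> verts (prism r)" "(i2, s) \<in> verts (prism r)"
      using lt t as by (auto simp: verts_prism)
    show "adj (prism r) (i, t) u \<longleftrightarrow> u = (i, s) \<or> u = (n, t) \<or> u = (pv, t)" for u
    proof (cases u)
      case (Pair j w)
      show ?thesis unfolding Pair adj_prism using t as lt eqs nx[of j] by auto
    qed
    show "\<not> adj (prism r) (i, s) (n, t)" "\<not> adj (prism r) (i, s) (pv, t)"
      "\<not> adj (prism r) (n, t) (pv, t)" "\<not> adj (prism r) (i2, t) (i, s)" 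
      "\<not> adj (prism r) (i2, s) (i, s)" "\<not> adj (prism r) (i2, s) (n, t)" "\<not> adj (prism r) (i2, s) (pv, t)"
      unfolding adj_prism using t ne eqs r4 by auto
    show "x = (i, t) \<or> x = (i2, t) \<and> card (edges (prism r)) = 12"
      if "adj (prism r) x (n, t)" "adj (prism r) x (pv, t)" for x
    proof (cases x)
      case (Pair j w)
      show ?thesis using that unfolding Pair adj_prism m using t as lt eqs nx[of j] ne r4 by auto
    qed
    \<comment> \<open>A neighbour of \<open>a\<close> other than \<open>(i, t)\<close> lies in the
      cycle of \<open>a\<close>, so it could meet \<open>(i2, t)\<close> only with first coordinate
      \<open>i2\<close>.\<close>
    show "\<not> adj (prism r) x (i2, t)" if x: "adj (prism r) x (i, s)" "x \<noteq> (i, t)" for x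
    proof (cases x)
      case (Pair j w)
      have j: "j < r" "w < 2" "s = w \<and> (i = nxt r j \<or> j = nxt r i) \<or> j = i \<and> w \<noteq> s"
        using x(1) unfolding Pair adj_prism by blast+
      then have "w = s" using t(3)[of w] x(2) Pair by blast
      moreover from this have "j \<noteq> i2" using j ne r4 eqs by metis
      ultimately show ?thesis unfolding Pair adj_prism using t(2) by blast
    qed
  qed
  then show ?thesis by blast
qed

section \<open>The triangular prism\<close>

text \<open>
  The vertices of the triangular prism are numbered so that 2 k and 2 k + 1 are partners and the even
  numbers form one of the triangles.
\<close>

definition triangular_edges :: "(nat \<times> nat) list" where
  "triangular_edges = [(0, 1), (0, 2), (1, 3), (2, 3), (0, 4), (2, 4), (1, 5), (3, 5), (4, 5)]"

text \<open>The sum of the two truncated differences is the absolute difference. An edge is tested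
  as soon as its larger end is labeled.\<close>

definition partial_graceful :: "nat list \<Rightarrow> bool" where
  "partial_graceful xs \<longleftrightarrow> distinct xs \<and>
     distinct (map (\<lambda>(i, j). (xs ! i - xs ! j) + (xs ! j - xs ! i))
       (filter (\<lambda>(i, j). j < length xs) triangular_edges))"

text \<open>
  A depth-first search: whenever the prefix xs of a labeling is completed by n further labels, the
  first of which is taken from ys, position 1 carries 9 and the label 6 does not occur.
\<close>

fun all_extensions :: "nat \<Rightarrow> nat list \<Rightarrow> nat list \<Rightarrow> bool" where
  "all_extensions 0 xs ys \<longleftrightarrow> xs ! 1 = 9 \<and> 6 \<notin> set xs"
| "all_extensions (Suc n) xs [] \<longleftrightarrow> True"
| "all_extensions (Suc n) xs (y # ys) \<longleftrightarrow>
     (if partial_graceful (xs @ [y]) then all_extensions n (xs @ [y]) [0..<10] else True) \<and>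
     all_extensions (Suc n) xs ys"

lemma all_extensions_3: "all_extensions 5 [3] [0..<10]"
  by code_simp

lemma all_extensions_Suc:
  "all_extensions (Suc n) xs ys \<Longrightarrow> y \<in> set ys \<Longrightarrow> partial_graceful (xs @ [y])
    \<Longrightarrow> all_extensions n (xs @ [y]) [0..<10]"
  by (induction ys) auto

text \<open>Justifies the pruning of the search: a prefix that fails the test has no graceful
  completion.\<close>

lemma partial_graceful_append: "partial_graceful (xs @ ys) \<Longrightarrow> partial_graceful xs"
proof -
  assume p: "partial_graceful (xs @ ys)"
  let ?g = "\<lambda>xs (i, j). (xs ! i - xs ! j) + (xs ! j - xs ! i) :: nat"
  let ?E = "\<lambda>n. filter (\<lambda>(i, j). j < n) triangular_edges"
  \<comment> \<open>The filter tests only \<open>j\<close>; by this fact both ends lie in the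
    prefix.\<close>
  have lt: "i < j" if "(i, j) \<in> set triangular_edges" for i j
    using that by (auto simp: triangular_edges_def)
  have g: "map (?g xs) (?E (length xs)) = map (?g (xs @ ys)) (?E (length xs))"
    by (auto simp: nth_append dest!: lt)
  have E: "?E (length xs) = filter (\<lambda>(i, j). j < length xs) (?E (length (xs @ ys)))"
    by (auto intro!: filter_cong)
  have d: "distinct (map (?g (xs @ ys)) (?E (length (xs @ ys))))" "distinct xs"
    using p by (simp_all add: partial_graceful_def)
  have "distinct (map (?g xs) (?E (length xs)))"
    unfolding g by (subst E) (rule distinct_map_filter[OF d(1)])
  then show ?thesis using d(2) unfolding partial_graceful_def by (rule conjI[rotated])
qed

text \<open>The given labeling is followed through the search tree, one prefix per level.\<close>

lemma partial_graceful_3: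
  assumes p: "partial_graceful [3, b, c, d, e, f]" and le: "b \<le> 9" "c \<le> 9" "d \<le> 9" "e \<le> 9" "f \<le> 9"
  shows "b = 9" "6 \<notin> {b, c, d, e, f}"
proof -
  have pre: "partial_graceful ([3] @ [b])" "partial_graceful ([3, b] @ [c])"
    "partial_graceful ([3, b, c] @ [d])" "partial_graceful ([3, b, c, d] @ [e])"
    "partial_graceful ([3, b, c, d, e] @ [f])"
    using p partial_graceful_append[of "[3, b]" "[c, d, e, f]"]
      partial_graceful_append[of "[3, b, c]" "[d, e, f]"]
      partial_graceful_append[of "[3, b, c, d]" "[e, f]"]
      partial_graceful_append[of "[3, b, c, d, e]" "[f]"] by simp_all
  have lt: "x \<in> set [0..<10]" if "x \<le> 9" for x using that by simp
  have "all_extensions (Suc (Suc (Suc (Suc (Suc 0))))) [3] [0..<10]"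
    using all_extensions_3 by (simp only: eval_nat_numeral BitM.simps One_nat_def)
  from all_extensions_Suc[OF this lt[OF le(1)] pre(1)]
  have "all_extensions (Suc (Suc (Suc (Suc 0)))) [3, b] [0..<10]" by (simp only: append.simps)
  from all_extensions_Suc[OF this lt[OF le(2)] pre(2)]
  have "all_extensions (Suc (Suc (Suc 0))) [3, b, c] [0..<10]" by (simp only: append.simps)
  from all_extensions_Suc[OF this lt[OF le(3)] pre(3)]
  have "all_extensions (Suc (Suc 0)) [3, b, c, d] [0..<10]" by (simp only: append.simps)
  from all_extensions_Suc[OF this lt[OF le(4)] pre(4)]
  have "all_extensions (Suc 0) [3, b, c, d, e] [0..<10]" by (simp only: append.simps)
  from all_extensions_Suc[OF this lt[OF le(5)] pre(5)]
  have "all_extensions 0 [3, b, c, d, e, f] [0..<10]" by (simp only: append.simps)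
  then show "b = 9" "6 \<notin> {b, c, d, e, f}" by auto
qed

locale triangular = simple_graph G m for G :: "'a graph" and m +
  fixes v v' t t' u u' :: 'a
  assumes m9: "m = 9"
    and vs: "verts G = {v, v', t, t', u, u'}" "distinct [v, v', t, t', u, u']"
    and adjs: "adj G v v'" "adj G v t" "adj G v' t'" "adj G t t'" "adj G v u" "adj G t u"
      "adj G v' u'" "adj G t' u'" "adj G u u'"
    and nonadjs: "\<not> adj G v t'" "\<not> adj G v u'"
begin

text \<open>Transfers the search to the graph: \<open>v\<close>, \<open>v'\<close>,
  \<open>t\<close>, \<open>t'\<close>, \<open>u\<close>, \<open>u'\<close> are the positions 0 to
  5.\<close>

lemma graceful_3:
  assumes f: "graceful_labeling G f" and v: "f v = 3"
  shows "f v' = 9" "\<And>x. x \<in> verts G \<Longrightarrow> f x \<noteq> 6"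
proof -
  have le: "f x \<le> 9" if "x \<in> verts G" for x using graceful_le[OF f that] m9 by simp
  have inj: "inj_on f (verts G)" and inje: "inj_on (edge_label f) (edges G)"
    using f by (auto simp: graceful_labeling_def)
  have g: "(f x - f y) + (f y - f x) = edge_label f {x, y}" for x y
    by (simp only: edge_label_doubleton)
  have dv: "distinct (map f [v, v', t, t', u, u'])"
    using inj vs by (subst distinct_map) simp
  have de: "distinct (map (edge_label f)
      [{v, v'}, {v, t}, {v', t'}, {t, t'}, {v, u}, {t, u}, {v', u'}, {t', u'}, {u, u'}])"
    (is "distinct (map _ ?es)")
  proof (subst distinct_map, intro conjI)
    show "distinct ?es" using vs(2) by (auto simp: doubleton_eq_iff)
    show "inj_on (edge_label f) (set ?es)"
      by (rule inj_on_subset[OF inje]) (use adjs in \<open>auto simp: adj_def\<close>)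
  qed
  have "partial_graceful [f v, f v', f t, f t', f u, f u']"
    unfolding partial_graceful_def
  proof
    show "distinct [f v, f v', f t, f t', f u, f u']" using dv by (simp only: list.map)
    have "map (\<lambda>(i, j). ([f v, f v', f t, f t', f u, f u'] ! i - [f v, f v', f t, f t', f u, f u'] ! j) +
        ([f v, f v', f t, f t', f u, f u'] ! j - [f v, f v', f t, f t', f u, f u'] ! i))
        (filter (\<lambda>(i, j). j < length [f v, f v', f t, f t', f u, f u']) triangular_edges) =
      map (edge_label f)
      [{v, v'}, {v, t}, {v', t'}, {t, t'}, {v, u}, {t, u}, {v', u'}, {t', u'}, {u, u'}]"
      by (simp add: triangular_edges_def g)
    then show "distinct (map (\<lambda>(i, j). ([f v, f v', f t, f t', f u, f u'] ! i - [f v, f v', f t, f t', f u, f u'] ! j) +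
        ([f v, f v', f t, f t', f u, f u'] ! j - [f v, f v', f t, f t', f u, f u'] ! i))
        (filter (\<lambda>(i, j). j < length [f v, f v', f t, f t', f u, f u']) triangular_edges))"
      using de by (simp only:)
  qed
  note * = partial_graceful_3[OF this[unfolded v]]
  have lev: "f v' \<le> 9" "f t \<le> 9" "f t' \<le> 9" "f u \<le> 9" "f u' \<le> 9" using le vs by auto
  show "f v' = 9" using *(1)[OF lev] .
  show "f x \<noteq> 6" if "x \<in> verts G" for x using *(2)[OF lev] that v unfolding vs(1) by auto
qed

text \<open>Complementing with m = 9 exchanges 3 with 6 and 9 with 0.\<close>

lemma graceful_6:
  assumes "graceful_labeling G f" and v: "f v = 6"
  shows "f v' = 0" "\<And>x. x \<in> verts G \<Longrightarrow> f x \<noteq> 3"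
proof -
  note c = graceful_3[OF graceful_complement[OF assms(1)]]
  show "f v' = 0" using c(1) v m9 by auto
  show "f x \<noteq> 3" if "x \<in> verts G" for x using c(2)[OF _ that] v m9 by auto
qed

lemma bob_wins_triangular_Alice_first:
  assumes l: "l \<le> m"
  shows "bob_wins G Bob [v' \<mapsto> l]"
proof -
  \<comment> \<open>3 on \<open>v\<close> demands 9 on \<open>v'\<close>, so it kills unless l = 9,
    and it is taken if l = 3. In these two cases 6 kills: it demands 0 on \<open>v'\<close>.\<close>
  define k :: nat where "k = (if l = 3 \<or> l = 9 then 6 else 3)"
  have L: "legal G [v' \<mapsto> l] v k"
    by (rule legal_singleton) (use l vs m9 in \<open>auto simp: k_def\<close>)
  have "dead G [v' \<mapsto> l, v \<mapsto> k]"
    unfolding dead_def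
  proof (intro notI, elim exE conjE)
    fix f assume f: "graceful_labeling G f" "\<forall>w j. [v' \<mapsto> l, v \<mapsto> k] w = Some j \<longrightarrow> f w = j"
    have fv: "f v = k" "f v' = l" using f(2) vs by auto
    have "v' \<in> verts G" using vs by simp
    then show False using graceful_3(1)[OF f(1)] graceful_6(1)[OF f(1)] graceful_6(2)[OF f(1), of v'] fv
      unfolding k_def by (cases "l = 3 \<or> l = 9") auto
  qed
  then show ?thesis by (rule bob_wins.bob[OF L bob_wins.dead])
qed

lemma bob_wins_triangular_Bob_first: "bob_wins G Bob Map.empty"
proof (rule bob_wins.bob[OF legal_empty bob_wins.alice])
  show "v \<in> verts G" "3 \<le> m" using vs m9 by auto
  show "dom [v \<mapsto> 3] \<noteq> verts G" using vs by auto
  fix x k assume L: "legal G [v \<mapsto> 3] x k"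
  have dead: "dead G p" if "p v = Some 3" "p w = Some 6" "w \<in> verts G" for p w
    unfolding dead_def
  proof (intro notI, elim exE conjE)
    fix f assume f: "graceful_labeling G f" "\<forall>w j. p w = Some j \<longrightarrow> f w = j"
    then have "f v = 3" "f w = 6" using that by auto
    then show False using graceful_3(2)[OF f(1)] that by blast
  qed
  have x: "x \<in> verts G" "x \<noteq> v" "k \<noteq> 3" using L by (auto simp: legal_def)
  show "bob_wins G Bob [v \<mapsto> 3, x \<mapsto> k]"
  proof (cases "k = 6")
    case True
    show ?thesis by (rule bob_wins.dead[OF dead[of _ x]]) (use x True in auto)
  next
    case False
    obtain w where w: "w \<in> {t', u'}" "w \<noteq> x" using vs(2) by auto
    have nw: "\<not> adj G w v" "w \<in> verts G" "w \<noteq> v"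
      using w(1) nonadjs[THEN not_adj_sym] vs by auto
    \<comment> \<open>The edges from \<open>x\<close> to \<open>v\<close> and to \<open>w\<close>
      can have equal labels only if k is halfway between 3 and 6.\<close>
    have k: "2 * k \<noteq> 9" by presburger
    have "gap 6 k \<noteq> k - 3" if "3 \<le> k" using that k by linarith
    moreover have "gap 6 k \<noteq> 3 - k" using False by linarith
    ultimately have L': "legal G [v \<mapsto> 3, x \<mapsto> k] w 6"
      by (intro legalI)
        (use w(2) nw x False m9 legal_consistent[OF L] adj_irrefl in \<open>auto split: if_splits\<close>)
    show ?thesis by (rule bob_wins.bob[OF L' bob_wins.dead[OF dead[of _ w]]]) (use nw x in auto)
  qed
qed

end

lemma prism_triangular:
  assumes "a \<in> verts (prism 3)"
  shows "\<exists>v t t' u u'. triangular (prism 3) v a t t' u u'"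
proof -
  obtain i s where a: "a = (i, s)" "i < 3" "s < 2" using assms by (auto simp: verts_prism)
  define w where "w = 1 - s"
  have "triangular (prism 3) (i, w) (i, s) (nxt 3 i, w) (nxt 3 i, s) (nxt 3 (nxt 3 i), w) (nxt 3 (nxt 3 i), s)"
  proof (intro triangular.intro triangular_axioms.intro simple_prism)
    show "card (edges (prism 3)) = 9" by (simp add: card_edges_prism)
  qed (use a(2,3) in \<open>auto simp: adj_prism verts_prism nxt_def w_def less_2_cases_iff numeral_3_eq_3 less_Suc_eq\<close>)
  then show ?thesis unfolding a(1) by blast
qed

section \<open>Conclusion for all prisms and both opening players\<close>

theorem theorem12:
  fixes r :: nat and first :: player
  assumes "r \<ge> 3"
  shows "has_winning_strategy (prism r) first Bob"
proof -
  interpret simple_graph "prism r" "card (edges (prism r))"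
    by (rule simple_prism[OF assms])
  have Alice_first: "bob_wins (prism r) Bob [a \<mapsto> l]"
    if al: "a \<in> verts (prism r)" "l \<le> card (edges (prism r))" for a l
  proof (cases "r = 3")
    case True
    then obtain v t t' u u' where "triangular (prism r) v a t t' u u'"
      using prism_triangular[of a] al by auto
    then show ?thesis using al(2) by (rule triangular.bob_wins_triangular_Alice_first)
  next
    case False
    then obtain v n1 n2 z z' where "star (prism r) v a n1 n2 z z'"
      using prism_star[OF _ al(1)] assms by auto
    then show ?thesis using al(2) by (rule star.bob_wins_Alice_first)
  qed
  have o: "(0, 0) \<in> verts (prism r)" using assms by (simp add: verts_prism)
  have Bob_first: "bob_wins (prism r) Bob Map.empty"
  proof (cases "r = 3")
    case True
    then obtain v t t' u u' where "triangular (prism r) v (0, 0) t t' u u'"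
      using prism_triangular[of "(0, 0)"] o by auto
    then show ?thesis by (rule triangular.bob_wins_triangular_Bob_first)
  next
    case False
    then obtain v n1 n2 z z' where "star (prism r) v (0, 0) n1 n2 z z'"
      using prism_star[OF _ o] assms by auto
    then show ?thesis by (rule star.bob_wins_Bob_first)
  qed
  \<comment> \<open>Alice may open anywhere, hence \<open>a\<close> and \<open>l\<close> are
    arbitrary in \<open>Alice_first\<close>; the vertex (0, 0) shows that the empty labeling is
    incomplete.\<close>
  have "bob_wins (prism r) Alice Map.empty"
    by (rule bob_wins.alice) (use o Alice_first in \<open>auto simp: legal_def\<close>)
  then have "bob_wins (prism r) first Map.empty" using Bob_first by (cases first) auto
  then show ?thesis by (rule bob_wins_imp_winning_strategy)
qed

end
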